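(* If a weighted signed graph $G$ is balanced, then $\mathrm{per}\, A(G)=\mathrm{per}\, A(|G|)$.
   Context: A weighted signed graph is a simple undirected graph whose edges carry nonzero real weights (positive or negative); its adjacency matrix $A(G)$ has $(i,j)$ entry equal to the weight of edge $\{i,j\}$ and $0$ otherwise. $|G|$ is obtained from $G$ by replacing every edge weight by its absolute value. A cycle is balanced if the product of the weights of its edges is positive, and $G$ is balanced if all its cycles are balanced. $\mathrm{per}$ denotes the permanent. *)

theory Defs
  imports "HOL-Analysis.Analysis"
begin

text \<open>The vertices are all elements of the finite type \<open>'v\<close>. Only the weights of members
  of \<open>edges G\<close> matter; \<open>weight G\<close> is unconstrained elsewhere.\<close>

record 'v wgraph =
  edges :: "'v set set"
  weight :: "'v set \<Rightarrow> real"

definition weighted_signed_graph :: "('v::finite) wgraph \<Rightarrow> bool" where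
  "weighted_signed_graph G \<longleftrightarrow>
     (\<forall>e\<in>edges G. card e = 2) \<and> (\<forall>e\<in>edges G. weight G e \<noteq> 0)"

definition adjacency_matrix :: "('v::finite) wgraph \<Rightarrow> real ^ 'v ^ 'v" where
  "adjacency_matrix G = (\<chi> i j. if {i, j} \<in> edges G then weight G {i, j} else 0)"

definition abs_graph :: "('v::finite) wgraph \<Rightarrow> 'v wgraph" where
  "abs_graph G = \<lparr>edges = edges G, weight = (\<lambda>e. \<bar>weight G e\<bar>)\<rparr>"

text \<open>A cycle is given by the list of its (at least three, pairwise distinct) vertices in cyclic
  order; the last vertex is joined to the first one.\<close>

definition cycle_edges :: "'v list \<Rightarrow> 'v set set" where
  "cycle_edges vs = {{vs ! i, vs ! (Suc i mod length vs)} | i. i < length vs}"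

definition is_cycle :: "('v::finite) wgraph \<Rightarrow> 'v list \<Rightarrow> bool" where
  "is_cycle G vs \<longleftrightarrow> length vs \<ge> 3 \<and> distinct vs \<and> cycle_edges vs \<subseteq> edges G"

definition balanced_cycle :: "('v::finite) wgraph \<Rightarrow> 'v list \<Rightarrow> bool" where
  "balanced_cycle G vs \<longleftrightarrow> (\<Prod>e\<in>cycle_edges vs. weight G e) > 0"

definition balanced :: "('v::finite) wgraph \<Rightarrow> bool" where
  "balanced G \<longleftrightarrow> (\<forall>vs. is_cycle G vs \<longrightarrow> balanced_cycle G vs)"

text \<open>The same formula as for \<open>det\<close>, without the signs.\<close>

definition permanent :: "'a::comm_ring_1 ^ 'n ^ 'n \<Rightarrow> 'a" where
  "permanent A = (\<Sum>p\<in>{p. p permutes (UNIV :: 'n set)}. \<Prod>i\<in>UNIV. A $ i $ p i)"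

lemma weighted_signed_graph_abs_graph:
  "weighted_signed_graph G \<Longrightarrow> weighted_signed_graph (abs_graph G)"
  by (simp add: weighted_signed_graph_def abs_graph_def)

lemma transpose_adjacency_matrix: "transpose (adjacency_matrix G) = adjacency_matrix G"
  by (simp add: transpose_def adjacency_matrix_def vec_eq_iff insert_commute)

lemma adjacency_matrix_abs_graph: "adjacency_matrix (abs_graph G) $ i $ j = \<bar>adjacency_matrix G $ i $ j\<bar>"
  by (simp add: adjacency_matrix_def abs_graph_def)

end

theory Submission
  imports Defs "HOL-Combinatorics.Cycles"
begin

text \<open>Every term of the permanent of \<open>A(G)\<close> is nonnegative, hence equal to its absolute value,
  which is the corresponding term for \<open>|G|\<close>. Indeed, a nonzero term factors over the cycles of
  its permutation. A cycle of length 1 cannot occur since \<open>G\<close> has no loops, a cycle of length 2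
  contributes the square of an edge weight, and a longer one contributes the weight product of
  a cycle of \<open>G\<close>, which is positive by balance.\<close>

text \<open>\<open>support p a\<close> stops just before the first positive power of
  \<open>p\<close> that fixes \<open>a\<close>, so \<open>p\<close> sends its last entry back to its
  first, as the index modulo the length does.\<close>

lemma support_nth_Suc_mod:
  assumes "permutation p" "i < least_power p a"
  shows "support p a ! (Suc i mod length (support p a)) = p (support p a ! i)"
proof (cases "Suc i = least_power p a")
  case True
  then have "p ((p ^^ i) a) = a"
    using least_power_of_permutation(1)[OF assms(1), of a] by (metis comp_apply funpow.simps(2))
  then show ?thesis
    using True assms(2) by simp
next
  case False
  then show ?thesis
    using assms(2) by simp
qed

lemma cycle_edges_support:
  assumes "permutation p"
  shows "cycle_edges (support p a) = (\<lambda>v. {v, p v}) ` set (support p a)"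
proof -
  let ?vs = "support p a"
  have "cycle_edges ?vs = (\<lambda>i. {?vs ! i, ?vs ! (Suc i mod length ?vs)}) ` {..<length ?vs}"
    unfolding cycle_edges_def by blast
  also have "\<dots> = (\<lambda>i. {?vs ! i, p (?vs ! i)}) ` {..<length ?vs}"
    using support_nth_Suc_mod[OF assms, of _ a] by (intro image_cong) simp_all
  also have "\<dots> = (\<lambda>v. {v, p v}) ` set ?vs"
    by (auto simp: image_image lessThan_atLeast0)
  finally show ?thesis .
qed

text \<open>If distinct \<open>u\<close> and \<open>v\<close> gave the same edge, \<open>p\<close>
  would swap them, and injectivity of \<open>p ^^ i\<close> would carry \<open>p (p v) = v\<close>
  back to \<open>p (p a) = a\<close>.\<close>

lemma inj_on_support_edges:
  assumes "permutation p" "p (p a) \<noteq> a"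
  shows "inj_on (\<lambda>v. {v, p v}) (set (support p a))"
proof (rule inj_onI)
  fix u v
  assume v: "v \<in> set (support p a)" and eq: "{u, p u} = {v, p v}"
  have "p (p v) \<noteq> v"
  proof
    assume "p (p v) = v"
    obtain i where i: "v = (p ^^ i) a"
      using v by auto
    have "(p ^^ i) (p (p a)) = p (p ((p ^^ i) a))"
      by (simp add: funpow_swap1)
    then have "(p ^^ i) (p (p a)) = (p ^^ i) a"
      using \<open>p (p v) = v\<close> i by simp
    moreover have "inj (p ^^ i)"
      using assms(1) by (intro inj_fn bij_is_inj) (simp add: permutation)
    ultimately show False
      using assms(2) by (auto dest: injD)
  qed
  with eq show "u = v"
    by (metis doubleton_eq_iff)
qed

lemma adjacency_prod_support_nonneg:
  assumes G: "weighted_signed_graph G" "balanced G"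
    and p: "permutation p" and edges: "\<And>v. {v, p v} \<in> edges G"
  shows "(\<Prod>v\<in>set (support p a). weight G {v, p v}) \<ge> 0"
proof -
  have neq: "p v \<noteq> v" for v
    using G(1) edges[of v] by (auto simp: weighted_signed_graph_def)
  have gt1: "least_power p a > 1"
    using least_power_gt_one[OF p neq] by simp
  show ?thesis
  proof (cases "p (p a) = a")
    case True
    then have "least_power p a \<le> 2"
      by (intro least_power_le) (simp_all add: numeral_2_eq_2)
    with gt1 have "least_power p a = 2"
      by simp
    then have "set (support p a) = {a, p a}"
      by (simp add: numeral_2_eq_2)
    then show ?thesis
      using True neq[of a] by (simp add: insert_commute del: set_map)
  next
    case False
    have "least_power p a \<noteq> 2"
      using False least_power_of_permutation(1)[OF p, of a] by (auto simp: numeral_2_eq_2)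
    with gt1 have "is_cycle G (support p a)"
      unfolding is_cycle_def cycle_edges_support[OF p]
      using edges cycle_of_permutation[OF p] by auto
    then have "(\<Prod>e\<in>cycle_edges (support p a). weight G e) > 0"
      using G(2) by (simp add: balanced_def balanced_cycle_def)
    then show ?thesis
      \<comment> \<open>Balance speaks of a product over the set of edges, the goal of one over
        vertices; injectivity of the map from \<open>v\<close> to \<open>{v, p v}\<close> identifies
        them.\<close>
      unfolding cycle_edges_support[OF p]
      by (simp add: prod.reindex[OF inj_on_support_edges[OF p False]] o_def del: set_map)
  qed
qed

lemma adjacency_prod_permutation_nonneg:
  fixes G :: "('v::finite) wgraph"
  assumes G: "weighted_signed_graph G" "balanced G" and p: "permutation p"
  shows "(\<Prod>i\<in>UNIV. adjacency_matrix G $ i $ p i) \<ge> 0"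
proof (cases "\<forall>v. {v, p v} \<in> edges G")
  case True
  \<comment> \<open>The orbits of \<open>p\<close> partition the vertices. As \<open>?C\<close> is a
    set of sets, each orbit is counted once, although each of its vertices generates it.\<close>
  let ?C = "range (\<lambda>a. set (support p a))"
  have "a \<in> set (support p a)" for a
    unfolding support_set[OF p] by (metis funpow_0 rangeI)
  then have "UNIV = \<Union> ?C"
    by blast
  then have "(\<Prod>i\<in>UNIV. adjacency_matrix G $ i $ p i)
      = (\<Prod>i\<in>\<Union> ?C. weight G {i, p i})"
    using True by (simp add: adjacency_matrix_def)
  also have "\<dots> = (\<Prod>S\<in>?C. \<Prod>i\<in>S. weight G {i, p i})"
    using prod.Union_disjoint[of ?C "\<lambda>i. weight G {i, p i}"] disjoint_support[OF p]
    by (simp add: disjoint_def)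
  also have "\<dots> \<ge> 0"
    using adjacency_prod_support_nonneg[OF G p] True by (intro prod_nonneg[of ?C]) blast
  finally show ?thesis .
next
  case False
  then have "(\<Prod>i\<in>UNIV. adjacency_matrix G $ i $ p i) = 0"
    by (intro prod_zero) (auto simp: adjacency_matrix_def)
  then show ?thesis
    by (rule eq_refl[OF sym])
qed

theorem theorem3:
  fixes G :: "('v::finite) wgraph"
  assumes "weighted_signed_graph G"
    and "balanced G"
  shows "permanent (adjacency_matrix G) = permanent (adjacency_matrix (abs_graph G))"
  unfolding permanent_def
proof (rule sum.cong)
  fix p :: "'v \<Rightarrow> 'v"
  assume "p \<in> {p. p permutes UNIV}"
  then have "permutation p"
    by (auto simp: permutation_permutes)
  \<comment> \<open>On the right the absolute values of the factors combine into that of the product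
    on the left, which is nonnegative.\<close>
  then show "(\<Prod>i\<in>UNIV. adjacency_matrix G $ i $ p i)
      = (\<Prod>i\<in>UNIV. adjacency_matrix (abs_graph G) $ i $ p i)"
    using adjacency_prod_permutation_nonneg[OF assms]
    by (simp add: adjacency_matrix_abs_graph flip: abs_prod)
qed simp

end
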